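(* Let $X\subset\mathbb{R}^N$ and $Y\subset\mathbb{R}^P$ be locally finite geometric simplicial complexes, let $f\colon X\to Y$ be a surjective simplicial map with finite fibres, and let $k\ge 1$. Then the collection of geometric simplices $\{\Gamma^{(k)}_{\mathbf{x}} : \mathbf{x}\in D^k(f)\}$ gives $D^k(f)$ the structure of a simplicial complex. In fact, $D^k(f)$ is in this way a simplicial subcomplex of $W^k(f)$ with the triangulation associated to $f$.
   Context: A simplicial map sends the vertices of each simplex to vertices of a simplex and is affine on each simplex. $W^k(f)=\{(x_1,\dots,x_k)\in X^k : f(x_1)=\dots=f(x_k)\}\subset(\mathbb{R}^N)^k$, and $D^k(f)$ is the closure in $X^k$ of $\{(x_1,\dots,x_k)\in X^k : f(x_1)=\dots=f(x_k),\ x_i\ne x_j\text{ for }i\ne j\}$. $\pi_\ell$ is the $\ell$-th projection to $X$. For a point $x$ of a simplicial complex, $\Gamma_x$ is the unique geometric simplex containing $x$ in its interior. For $\mathbf{x}\in W^k(f)$ put $y=f(\pi_1(\mathbf{x}))$ and let $w_0,\dots,w_n$ be the vertices of $\Gamma_y$. For each $\ell$, $f$ maps $\Gamma_{\pi_\ell(\mathbf{x})}$ isomorphically onto $\Gamma_y$; let $v^{(\ell)}_j$ be the vertex of $\Gamma_{\pi_\ell(\mathbf{x})}$ with $f(v^{(\ell)}_j)=w_j$. Then $\Gamma^{(k)}_{\mathbf{x}}\subset(\mathbb{R}^N)^k$ is the geometric $n$-simplex with vertices $(v^{(1)}_j,\dots,v^{(k)}_j)$, $j=0,\dots,n$. The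 triangulation of $W^k(f)$ associated to $f$ is the simplicial complex structure whose simplices are the $\Gamma^{(k)}_{\mathbf{x}}$, $\mathbf{x}\in W^k(f)$. *)

theory Defs
  imports "HOL-Analysis.Analysis"
begin

(* The complex is the set K of its simplices; the underlying space is \<Union>K.
   The library's simplicial_complex is not used: it requires finitely many simplices
   and, being closed under face_of, contains the empty simplex. In the last clause
   \<sigma> \<inter> \<tau> may be empty, {} being a face of every convex set. *)
definition geometric_complex :: "'a::euclidean_space set set \<Rightarrow> bool" where
  "geometric_complex K \<longleftrightarrow>
     (\<forall>\<sigma>\<in>K. \<sigma> \<noteq> {} \<and> (\<exists>n. n simplex \<sigma>)) \<and>
     (\<forall>\<sigma>\<in>K. \<forall>F. F face_of \<sigma> \<and> F \<noteq> {} \<longrightarrow> F \<in> K) \<and>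
     (\<forall>\<sigma>\<in>K. \<forall>\<tau>\<in>K. (\<sigma> \<inter> \<tau>) face_of \<sigma> \<and> (\<sigma> \<inter> \<tau>) face_of \<tau>)"

(* Local finiteness at every point of the underlying space in its subspace topology. *)
definition locally_finite_complex :: "'a::euclidean_space set set \<Rightarrow> bool" where
  "locally_finite_complex K \<longleftrightarrow>
     geometric_complex K \<and> locally_finite_in (top_of_set (\<Union>K)) K"

definition subcomplex :: "'a::euclidean_space set set \<Rightarrow> 'a set set \<Rightarrow> bool" where
  "subcomplex L K \<longleftrightarrow> geometric_complex K \<and> geometric_complex L \<and> L \<subseteq> K"

definition complex_structure_on :: "'a::euclidean_space set set \<Rightarrow> 'a set \<Rightarrow> bool" where
  "complex_structure_on K S \<longleftrightarrow> geometric_complex K \<and> \<Union>K = S"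

definition verts :: "'a::euclidean_space set \<Rightarrow> 'a set" where
  "verts \<sigma> = {v. v extreme_point_of \<sigma>}"

definition affine_map_on :: "'a::euclidean_space set \<Rightarrow> ('a \<Rightarrow> 'b::euclidean_space) \<Rightarrow> bool" where
  "affine_map_on S f \<longleftrightarrow>
     (\<forall>x\<in>S. \<forall>y\<in>S. \<forall>t\<in>{0..1}. f ((1 - t) *\<^sub>R x + t *\<^sub>R y) = (1 - t) *\<^sub>R f x + t *\<^sub>R f y)"

(* Only the values of f on \<Union>K matter; f maps \<Union>K into \<Union>L as a consequence.
   The images of the vertices of \<sigma> may coincide; they span a face of \<tau>. *)
definition simplicial_map ::
  "'a::euclidean_space set set \<Rightarrow> 'b::euclidean_space set set \<Rightarrow> ('a \<Rightarrow> 'b) \<Rightarrow> bool" where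
  "simplicial_map K L f \<longleftrightarrow>
     (\<forall>\<sigma>\<in>K. (\<exists>\<tau>\<in>L. f ` verts \<sigma> \<subseteq> verts \<tau>) \<and> affine_map_on \<sigma> f)"

definition carrier_simplex :: "'a::euclidean_space set set \<Rightarrow> 'a \<Rightarrow> 'a set" where
  "carrier_simplex K x = (THE \<sigma>. \<sigma> \<in> K \<and> x \<in> rel_interior \<sigma>)"

(* A k-tuple of points is a vector indexed by a finite type 'k with CARD('k) = k. *)
definition cartesian_power :: "'a::euclidean_space set \<Rightarrow> ('a ^ 'k) set" where
  "cartesian_power X = {x. \<forall>l. x $ l \<in> X}"

definition W_k :: "'a::euclidean_space set \<Rightarrow> ('a \<Rightarrow> 'b) \<Rightarrow> ('a ^ 'k) set" where
  "W_k X f = {x \<in> cartesian_power X. \<forall>i j. f (x $ i) = f (x $ j)}"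

definition D_k :: "'a::euclidean_space set \<Rightarrow> ('a \<Rightarrow> 'b) \<Rightarrow> ('a ^ 'k) set" where
  "D_k X f = (top_of_set (cartesian_power X)) closure_of
     {x \<in> cartesian_power X. (\<forall>i j. f (x $ i) = f (x $ j)) \<and> (\<forall>i j. i \<noteq> j \<longrightarrow> x $ i \<noteq> x $ j)}"

definition common_value :: "('a \<Rightarrow> 'b) \<Rightarrow> 'a ^ 'k \<Rightarrow> 'b" where
  "common_value f x = (THE y. \<forall>l. f (x $ l) = y)"

definition vertex_over :: "'a::euclidean_space set \<Rightarrow> ('a \<Rightarrow> 'b) \<Rightarrow> 'b \<Rightarrow> 'a" where
  "vertex_over \<sigma> f w = (THE v. v \<in> verts \<sigma> \<and> f v = w)"

(* Meaningful only for x in W_k (\<Union>K) f, where the definite descriptions above are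
   well defined as f is injective on the simplices of K. *)
definition Gamma_k ::
  "'a::euclidean_space set set \<Rightarrow> 'b::euclidean_space set set \<Rightarrow> ('a \<Rightarrow> 'b) \<Rightarrow> 'a ^ 'k \<Rightarrow> ('a ^ 'k) set"
  where
  "Gamma_k K L f x = convex hull
     ((\<lambda>w. \<chi> l. vertex_over (carrier_simplex K (x $ l)) f w) `
        verts (carrier_simplex L (common_value f x)))"

definition associated_triangulation ::
  "'a::euclidean_space set set \<Rightarrow> 'b::euclidean_space set set \<Rightarrow> ('a \<Rightarrow> 'b) \<Rightarrow> ('a ^ 'k) set set" where
  "associated_triangulation K L f = Gamma_k K L f ` W_k (\<Union>K) f"

end

theory Submission
  imports Defs
begin

text \<open>
  Finiteness of the fibres makes \<open>f\<close> injective on each simplex, hence an affine isomorphism onto a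
  simplex of \<open>L\<close>. Therefore \<open>\<Gamma>\<^sub>x\<close> is the fibre product over \<open>f\<close> of the carriers of the
  coordinates of \<open>x\<close>, and every coordinate projection restricts to a bijection, linear on the ambient
  space, of \<open>\<Gamma>\<^sub>x\<close> onto the corresponding carrier. Simplices, relative interiors and faces
  are transported through these projections, which gives the triangulation of \<open>W\<close>.

  Let \<open>D\<^sub>0\<close> be the set of points of \<open>W\<close> with distinct coordinates. If \<open>x \<in> D\<^sub>0\<close>, then
  the carriers of its coordinates are distinct, so the relative interior of \<open>\<Gamma>\<^sub>x\<close> lies in
  \<open>D\<^sub>0\<close> and \<open>\<Gamma>\<^sub>x \<subseteq> D\<close>. Near a given point, \<open>D\<^sub>0\<close> is covered by finitely many such
  \<open>\<Gamma>\<^sub>x\<close> because \<open>K\<close> is locally finite. Hence \<open>D\<close> is the union of the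
  \<open>\<Gamma>\<^sub>x\<close> with \<open>x \<in> D\<^sub>0\<close>, a union of simplices of the triangulation of \<open>W\<close>.
\<close>

section \<open>Convex sets and affine maps\<close>

text \<open>An affine dependence in \<open>T\<close> pushes forward along \<open>p\<close>;
  injectivity keeps its coefficients from merging. Applied below to a coordinate projection.\<close>

lemma affine_independent_linear_preimage:
  assumes "linear p" "inj_on p T" "\<not> affine_dependent (p ` T)"
  shows "\<not> affine_dependent T"
proof
  assume "affine_dependent T"
  then obtain S u v where S: "finite S" "S \<subseteq> T" "sum u S = 0" "v \<in> S" "u v \<noteq> 0"
      "(\<Sum>v\<in>S. u v *\<^sub>R v) = 0"
    unfolding affine_dependent_explicit by blast
  have inj: "inj_on p S"
    using assms(2) S(2) inj_on_subset by blast
  define u' where "u' = u \<circ> inv_into S p"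
  have u': "u' (p x) = u x" if "x \<in> S" for x
    using that inj by (simp add: u'_def)
  have "sum u' (p ` S) = 0"
    using S(3) u' by (simp add: sum.reindex[OF inj])
  moreover have "(\<Sum>w\<in>p ` S. u' w *\<^sub>R w) = p (\<Sum>v\<in>S. u v *\<^sub>R v)"
    using u' by (simp add: sum.reindex[OF inj] linear_sum[OF assms(1)] linear_cmul[OF assms(1)])
  then have "(\<Sum>w\<in>p ` S. u' w *\<^sub>R w) = 0"
    using S(6) linear_0[OF assms(1)] by simp
  moreover have "p ` S \<subseteq> p ` T" "finite (p ` S)"
    using S by auto
  moreover have "\<exists>w\<in>p ` S. u' w \<noteq> 0"
    using S(4,5) u' by auto
  ultimately have "affine_dependent (p ` T)"
    unfolding affine_dependent_explicit by blast
  with assms(3) show False by blast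
qed

text \<open>Induction on dimension: a point off the relative interior lies on a facet, whose
  dimension is one lower.\<close>

lemma polytope_point_in_rel_interior_of_face:
  fixes S :: "'a::euclidean_space set"
  assumes "polytope S" "x \<in> S"
  shows "\<exists>F. F face_of S \<and> x \<in> rel_interior F"
  using assms
\<comment> \<open>Since \<open>aff_dim\<close> is at least -1, the shift by 1 makes the measure
  nonnegative before \<open>nat\<close> truncates.\<close>
proof (induction "nat (aff_dim S + 1)" arbitrary: S rule: less_induct)
  case less
  show ?case
  proof (cases "x \<in> rel_interior S")
    case True
    then show ?thesis
      using less.prems face_of_refl polytope_imp_convex by blast
  next
    case False
    then obtain F where F: "F facet_of S" "x \<in> F"
      using rel_boundary_of_polyhedron[OF polytope_imp_polyhedron[OF less.prems(1)]] less.prems by blast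
    have face: "F face_of S"
      using F facet_of_imp_face_of by blast
    have "aff_dim F = aff_dim S - 1"
      using F by (simp add: facet_of_def)
    moreover have "aff_dim F \<ge> -1"
      by (rule aff_dim_geq)
    ultimately have "nat (aff_dim F + 1) < nat (aff_dim S + 1)"
      by simp
    then obtain G where "G face_of F" "x \<in> rel_interior G"
      using less.hyps less.prems F face face_of_polytope_polytope by blast
    then show ?thesis
      using face face_of_trans by blast
  qed
qed

lemma affine_map_onD:
  "affine_map_on S f \<Longrightarrow> x \<in> S \<Longrightarrow> y \<in> S \<Longrightarrow> 0 \<le> t \<Longrightarrow> t \<le> 1 \<Longrightarrow>
    f ((1 - t) *\<^sub>R x + t *\<^sub>R y) = (1 - t) *\<^sub>R f x + t *\<^sub>R f y"
  unfolding affine_map_on_def by auto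

lemma convex_affine_image:
  assumes "affine_map_on S f" "convex S"
  shows "convex (f ` S)"
  unfolding convex_alt
proof clarify
  fix x y and t :: real
  assume "x \<in> S" "y \<in> S" "0 \<le> t" "t \<le> 1"
  moreover from this have "(1 - t) *\<^sub>R x + t *\<^sub>R y \<in> S"
    using assms(2) by (simp add: convex_alt)
  ultimately show "(1 - t) *\<^sub>R f x + t *\<^sub>R f y \<in> f ` S"
    using affine_map_onD[OF assms(1)] by (metis imageI)
qed

lemma convex_affine_preimage:
  assumes "affine_map_on S f" "convex S" "convex T"
  shows "convex {x \<in> S. f x \<in> T}"
  using assms unfolding convex_alt by (auto simp: affine_map_onD)

text \<open>Both inclusions follow from minimality of the hull, as preimages and images of convex
  sets under \<open>f\<close> are convex; \<open>f\<close> is affine on the hull only.\<close>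

lemma convex_hull_affine_image:
  assumes "affine_map_on (convex hull V) f"
  shows "f ` (convex hull V) = convex hull (f ` V)"
proof
  have "convex hull V \<subseteq> {x \<in> convex hull V. f x \<in> convex hull (f ` V)}"
    using convex_affine_preimage[OF assms] by (intro hull_minimal) (auto intro: hull_inc)
  then show "f ` (convex hull V) \<subseteq> convex hull (f ` V)"
    by auto
  show "convex hull (f ` V) \<subseteq> f ` (convex hull V)"
    using convex_affine_image[OF assms] by (intro hull_minimal) (auto intro: hull_inc)
qed

lemma open_segment_affine_image:
  assumes "affine_map_on S f" "convex S" "inj_on f S" "a \<in> S" "b \<in> S"
  shows "open_segment (f a) (f b) = f ` open_segment a b"
proof (cases "a = b")
  case False
  then have "f a \<noteq> f b"
    using assms by (meson inj_onD)
  show ?thesis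
  proof
    show "open_segment (f a) (f b) \<subseteq> f ` open_segment a b"
    proof
      fix y assume "y \<in> open_segment (f a) (f b)"
      then obtain t where t: "0 < t" "t < 1" "y = (1 - t) *\<^sub>R f a + t *\<^sub>R f b"
        by (auto simp: in_segment)
      then have "y = f ((1 - t) *\<^sub>R a + t *\<^sub>R b)"
        using affine_map_onD[OF assms(1,4,5)] by simp
      moreover have "(1 - t) *\<^sub>R a + t *\<^sub>R b \<in> open_segment a b"
        using t False by (auto simp: in_segment)
      ultimately show "y \<in> f ` open_segment a b" by blast
    qed
    show "f ` open_segment a b \<subseteq> open_segment (f a) (f b)"
    proof clarify
      fix x assume "x \<in> open_segment a b"
      then obtain t where t: "0 < t" "t < 1" "x = (1 - t) *\<^sub>R a + t *\<^sub>R b"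
        by (auto simp: in_segment)
      then have "f x = (1 - t) *\<^sub>R f a + t *\<^sub>R f b"
        using affine_map_onD[OF assms(1,4,5)] by simp
      then show "f x \<in> open_segment (f a) (f b)"
        using t \<open>f a \<noteq> f b\<close> by (auto simp: in_segment)
    qed
  qed
qed simp

text \<open>Extreme points are defined through open segments, which an injective affine map carries
  to open segments.\<close>

lemma verts_affine_image:
  assumes "affine_map_on S f" "convex S" "inj_on f S"
  shows "verts (f ` S) = f ` verts S"
proof -
  have "f v \<in> open_segment (f a) (f b) \<longleftrightarrow> v \<in> open_segment a b"
    if "v \<in> S" "a \<in> S" "b \<in> S" for v a b
  proof -
    have "open_segment a b \<subseteq> S"
      using that assms(2) by (meson convex_contains_open_segment)
    then show ?thesis
      unfolding open_segment_affine_image[OF assms that(2,3)]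
      using assms(3) that by (meson inj_on_image_mem_iff)
  qed
  then show ?thesis
    unfolding verts_def extreme_point_of_def by auto
qed

text \<open>A point \<open>z\<close> is relatively interior iff every segment from a point
  \<open>x\<close> of the set to \<open>z\<close> can be prolonged beyond \<open>z\<close> inside
  the set; \<open>f\<close> preserves such prolongations.\<close>

lemma rel_interior_affine_image:
  fixes S :: "'a::euclidean_space set" and f :: "'a \<Rightarrow> 'b::euclidean_space"
  assumes "affine_map_on S f" "convex S" "z \<in> rel_interior S"
  shows "f z \<in> rel_interior (f ` S)"
proof -
  have zS: "z \<in> S"
    using assms(3) rel_interior_subset by blast
  have "\<exists>e>1. (1 - e) *\<^sub>R f x + e *\<^sub>R f z \<in> f ` S" if x: "x \<in> S" for x
  proof -
    obtain e where e: "e > 1" "(1 - e) *\<^sub>R x + e *\<^sub>R z \<in> S"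
      using convex_rel_interior_iff[OF assms(2)] assms(3) x by blast
    \<comment> \<open>The factor \<open>e > 1\<close> lies outside the range where \<open>f\<close>
      is known to be affine. So \<open>z\<close> is written as a convex combination of
      \<open>x\<close> and \<open>w\<close>, and the resulting equation is solved for
      \<open>f w\<close>.\<close>
    define w where "w = (1 - e) *\<^sub>R x + e *\<^sub>R z"
    have "z = (1 - 1 / e) *\<^sub>R x + (1 / e) *\<^sub>R w"
      using e(1) by (simp add: w_def algebra_simps)
    then have "f z = (1 - 1 / e) *\<^sub>R f x + (1 / e) *\<^sub>R f w"
      using affine_map_onD[OF assms(1) x, of w "1 / e"] e by (simp add: w_def)
    then have "e *\<^sub>R f z = (e * (1 - 1 / e)) *\<^sub>R f x + (e * (1 / e)) *\<^sub>R f w"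
      by (simp only: scaleR_add_right scaleR_scaleR)
    moreover have "e * (1 - 1 / e) = e - 1" "e * (1 / e) = 1"
      using e(1) by (simp_all add: right_diff_distrib)
    ultimately have "e *\<^sub>R f z = (e - 1) *\<^sub>R f x + f w"
      by simp
    then have "f w = (1 - e) *\<^sub>R f x + e *\<^sub>R f z"
      by (simp add: algebra_simps)
    then show ?thesis
      using e w_def by (metis imageI)
  qed
  moreover have "convex (f ` S)" "f ` S \<noteq> {}"
    using convex_affine_image[OF assms(1,2)] zS by auto
  ultimately show ?thesis
    by (subst convex_rel_interior_iff) auto
qed

section \<open>Simplices and carriers\<close>

lemma simplex_verts:
  assumes "n simplex \<sigma>"
  shows "convex hull verts \<sigma> = \<sigma>" "\<not> affine_dependent (verts \<sigma>)" "finite (verts \<sigma>)"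
proof -
  obtain C where C: "\<not> affine_dependent C" "\<sigma> = convex hull C"
    using assms by (auto simp: simplex_def)
  then have "verts \<sigma> = C"
    by (auto simp: verts_def extreme_point_of_convex_hull_affine_independent)
  with C show "convex hull verts \<sigma> = \<sigma>" "\<not> affine_dependent (verts \<sigma>)" "finite (verts \<sigma>)"
    by (auto simp: aff_independent_finite)
qed

lemma geometric_complexD:
  assumes "geometric_complex K" "\<sigma> \<in> K"
  shows "\<sigma> \<noteq> {}" "polytope \<sigma>" "convex \<sigma>" "convex hull verts \<sigma> = \<sigma>"
    "\<not> affine_dependent (verts \<sigma>)" "finite (verts \<sigma>)"
proof -
  obtain n where n: "n simplex \<sigma>" "\<sigma> \<noteq> {}"
    using assms unfolding geometric_complex_def by blast
  show "\<sigma> \<noteq> {}" "polytope \<sigma>" "convex \<sigma>" "convex hull verts \<sigma> = \<sigma>"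
    "\<not> affine_dependent (verts \<sigma>)" "finite (verts \<sigma>)"
    using n simplex_verts[OF n(1)] simplex_imp_polytope polytope_imp_convex by blast+
qed

lemma geometric_complex_face:
  "geometric_complex K \<Longrightarrow> \<sigma> \<in> K \<Longrightarrow> F face_of \<sigma> \<Longrightarrow> F \<noteq> {} \<Longrightarrow> F \<in> K"
  unfolding geometric_complex_def by blast

text \<open>The face \<open>\<sigma> \<inter> \<tau>\<close> of \<open>\<sigma>\<close> meets the
  relative interior of \<open>\<sigma>\<close>, hence is all of \<open>\<sigma>\<close>.\<close>

lemma rel_interior_imp_face:
  assumes "geometric_complex K" "\<sigma> \<in> K" "\<tau> \<in> K" "x \<in> rel_interior \<sigma>" "x \<in> \<tau>"
  shows "\<sigma> face_of \<tau>"
proof -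
  have faces: "\<sigma> \<inter> \<tau> face_of \<sigma>" "\<sigma> \<inter> \<tau> face_of \<tau>"
    using assms(1-3) unfolding geometric_complex_def by blast+
  have "x \<in> (\<sigma> \<inter> \<tau>) \<inter> rel_interior \<sigma>"
    using assms(4,5) rel_interior_subset by blast
  then have "\<sigma> \<subseteq> \<sigma> \<inter> \<tau>"
    using subset_of_face_of[OF faces(1) order_refl] by blast
  then show ?thesis
    using faces(2) by (simp add: inf.absorb1)
qed

text \<open>Two simplices with a common relatively interior point are faces of each other, so the
  description defining the carrier is unique.\<close>

lemma carrier_simplex_eqI:
  assumes "geometric_complex K" "\<sigma> \<in> K" "x \<in> rel_interior \<sigma>"
  shows "carrier_simplex K x = \<sigma>"
  unfolding carrier_simplex_def
proof (rule the_equality)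
  fix \<tau> assume "\<tau> \<in> K \<and> x \<in> rel_interior \<tau>"
  moreover from this assms have "x \<in> \<sigma>" "x \<in> \<tau>"
    using rel_interior_subset by blast+
  ultimately have "\<sigma> face_of \<tau>" "\<tau> face_of \<sigma>"
    using assms rel_interior_imp_face by blast+
  then show "\<tau> = \<sigma>"
    using face_of_imp_subset by blast
qed (use assms in blast)

lemma carrier_simplex:
  assumes "geometric_complex K" "x \<in> \<Union>K"
  shows "carrier_simplex K x \<in> K" "x \<in> rel_interior (carrier_simplex K x)"
    "x \<in> carrier_simplex K x"
proof -
  obtain \<sigma> where \<sigma>: "\<sigma> \<in> K" "x \<in> \<sigma>"
    using assms(2) by blast
  then obtain F where F: "F face_of \<sigma>" "x \<in> rel_interior F"
    using polytope_point_in_rel_interior_of_face geometric_complexD(2)[OF assms(1)] by blast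
  moreover have "F \<noteq> {}"
    using F by auto
  ultimately have "F \<in> K"
    using geometric_complex_face[OF assms(1)] \<sigma> by blast
  then show "carrier_simplex K x \<in> K" "x \<in> rel_interior (carrier_simplex K x)"
    using carrier_simplex_eqI[OF assms(1) _ F(2)] F(2) by auto
  then show "x \<in> carrier_simplex K x"
    using rel_interior_subset by blast
qed

section \<open>Fibre products of simplices\<close>

text \<open>With the carriers of the coordinates of \<open>x\<close> as \<open>s\<close> this is
  \<open>Gamma_k\<close> at \<open>x\<close>, described by membership instead of as a hull, so that
  arguments can run coordinatewise.\<close>

definition fibre_product :: "('a::euclidean_space \<Rightarrow> 'b) \<Rightarrow> ('k \<Rightarrow> 'a set) \<Rightarrow> ('a ^ 'k) set" where
  "fibre_product f s = {z. (\<forall>l. z $ l \<in> s l) \<and> (\<forall>i j. f (z $ i) = f (z $ j))}"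

lemma linear_vec_nth: "linear (\<lambda>z :: 'a::real_normed_vector ^ 'k. z $ l)"
  by (rule bounded_linear.linear[OF bounded_linear_vec_nth])

text \<open>In each coordinate an open segment projects to an open segment or to a point, and the
  face property of \<open>c l\<close> in \<open>s l\<close> applies there.\<close>

lemma fibre_product_face:
  fixes s c :: "'k::finite \<Rightarrow> 'a::euclidean_space set"
  assumes "convex (fibre_product f s)" "\<And>l. c l face_of s l"
  shows "fibre_product f c face_of fibre_product f s"
proof -
  have conv: "convex (c l)" and sub: "c l \<subseteq> s l" for l
    using assms(2) face_of_imp_convex face_of_imp_subset by blast+
  \<comment> \<open>Convexity of the smaller product is inherited through linear preimages, as
    nothing is assumed about \<open>f\<close> itself.\<close>
  have eq: "fibre_product f c = fibre_product f s \<inter> (\<Inter>l. (\<lambda>z. z $ l) -` c l)"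
    using sub by (auto simp: fibre_product_def)
  have convex_c: "convex (fibre_product f c)"
    unfolding eq using assms(1) conv
    by (intro convex_Int convex_INT convex_linear_vimage linear_vec_nth)
  have endpoints: "a \<in> fibre_product f c \<and> b \<in> fibre_product f c"
    if a: "a \<in> fibre_product f s" and b: "b \<in> fibre_product f s"
      and z: "z \<in> fibre_product f c" "z \<in> open_segment a b" for a b z
  proof -
    obtain t where t: "0 < t" "t < 1" "z = (1 - t) *\<^sub>R a + t *\<^sub>R b"
      using z(2) by (auto simp: in_segment)
    have "a $ l \<in> c l \<and> b $ l \<in> c l" for l
    proof -
      have "a $ l \<in> s l" "b $ l \<in> s l" "z $ l \<in> c l"
        using a b z by (auto simp: fibre_product_def)
      moreover have zl: "z $ l = (1 - t) *\<^sub>R a $ l + t *\<^sub>R b $ l"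
        using t(3) by simp
      \<comment> \<open>Distinct \<open>a\<close> and \<open>b\<close> may agree in coordinate
        \<open>l\<close>; the projected segment is then a single point.\<close>
      moreover have "z $ l = a $ l" if "a $ l = b $ l"
        unfolding zl that by (simp add: algebra_simps)
      ultimately show ?thesis
        using face_ofD[OF assms(2), of "z $ l" "a $ l" "b $ l"] t
        by (cases "a $ l = b $ l") (auto simp: in_segment)
    qed
    then show ?thesis
      using a b by (simp add: fibre_product_def)
  qed
  show ?thesis
    unfolding face_of_def
  proof (intro conjI ballI impI convex_c)
    show "fibre_product f c \<subseteq> fibre_product f s"
      using eq by blast
  qed (use endpoints in blast)+
qed

section \<open>Simplicial maps with finite fibres\<close>

locale finite_fibre_simplicial_map =
  fixes K :: "'a::euclidean_space set set" and L :: "'b::euclidean_space set set" and f :: "'a \<Rightarrow> 'b"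
  assumes loc_fin_K: "locally_finite_complex K"
    and complex_L: "geometric_complex L"
    and simplicial: "simplicial_map K L f"
    and surj: "f ` (\<Union>K) = \<Union>L"
    and finite_fibres: "\<forall>y\<in>\<Union>L. finite {x \<in> \<Union>K. f x = y}"
begin

lemma complex_K: "geometric_complex K"
  using loc_fin_K by (simp add: locally_finite_complex_def)

lemma affine_on_simplex: "\<sigma> \<in> K \<Longrightarrow> affine_map_on \<sigma> f"
  using simplicial by (simp add: simplicial_map_def)

text \<open>If \<open>f\<close> identified two distinct points of a simplex, it would be constant on
  the segment between them, and a fibre would be infinite.\<close>

lemma inj_on_simplex:
  assumes "\<sigma> \<in> K"
  shows "inj_on f \<sigma>"
proof (rule inj_onI, rule ccontr)
  fix x y assume xy: "x \<in> \<sigma>" "y \<in> \<sigma>" "f x = f y" "x \<noteq> y"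
  have "closed_segment x y \<subseteq> {z \<in> \<Union>K. f z = f x}"
  proof
    fix z assume z: "z \<in> closed_segment x y"
    then obtain t where "0 \<le> t" "t \<le> 1" "z = (1 - t) *\<^sub>R x + t *\<^sub>R y"
      by (auto simp: in_segment)
    then have "f z = (1 - t) *\<^sub>R f x + t *\<^sub>R f y"
      using affine_map_onD[OF affine_on_simplex[OF assms] xy(1,2)] by simp
    then have "f z = f x"
      using xy(3) by (simp add: algebra_simps)
    moreover have "z \<in> \<sigma>"
      using z xy(1,2) geometric_complexD(3)[OF complex_K assms] closed_segment_subset by blast
    ultimately show "z \<in> {z \<in> \<Union>K. f z = f x}"
      using assms by blast
  qed
  moreover have "f x \<in> \<Union>L"
    using assms xy(1) surj by blast
  ultimately have "finite (closed_segment x y)"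
    using finite_fibres finite_subset by blast
  with xy(4) show False by simp
qed

text \<open>The image is spanned by some of the affinely independent vertices of a simplex of
  \<open>L\<close>, hence is a face of it.\<close>

lemma image_simplex:
  assumes "\<sigma> \<in> K"
  shows "f ` \<sigma> \<in> L"
proof -
  obtain \<tau> where \<tau>: "\<tau> \<in> L" "f ` verts \<sigma> \<subseteq> verts \<tau>"
    using simplicial assms unfolding simplicial_map_def by blast
  note \<sigma> = geometric_complexD[OF complex_K assms] and \<tau>' = geometric_complexD[OF complex_L \<tau>(1)]
  have "f ` \<sigma> = convex hull (f ` verts \<sigma>)"
    using convex_hull_affine_image[of "verts \<sigma>" f] affine_on_simplex[OF assms] \<sigma>(4) by simp
  then have "f ` \<sigma> face_of \<tau>"
    using face_of_convex_hull_affine_independent[OF \<tau>'(5)] \<tau>(2) \<tau>'(4) by auto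
  then show ?thesis
    using geometric_complex_face[OF complex_L \<tau>(1)] \<sigma>(1) by blast
qed

definition compatible :: "('k \<Rightarrow> 'a set) \<Rightarrow> 'b set \<Rightarrow> bool" where
  "compatible s \<tau> \<longleftrightarrow> (\<forall>l. s l \<in> K \<and> f ` s l = \<tau>)"

lemma convex_fibre_product:
  fixes s :: "'k::finite \<Rightarrow> 'a set"
  assumes "\<And>l. s l \<in> K"
  shows "convex (fibre_product f s)"
  unfolding convex_alt
proof (intro ballI allI impI)
  fix x y and t :: real
  assume xy: "x \<in> fibre_product f s" "y \<in> fibre_product f s" and t: "0 \<le> t \<and> t \<le> 1"
  have f: "f (((1 - t) *\<^sub>R x + t *\<^sub>R y) $ l) = (1 - t) *\<^sub>R f (x $ l) + t *\<^sub>R f (y $ l)" for l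
  proof -
    have "x $ l \<in> s l" "y $ l \<in> s l"
      using xy by (simp_all add: fibre_product_def)
    then show ?thesis
      using affine_map_onD[OF affine_on_simplex[OF assms], of "x $ l" l "y $ l" t] t by simp
  qed
  have "((1 - t) *\<^sub>R x + t *\<^sub>R y) $ l \<in> s l" for l
    using geometric_complexD(3)[OF complex_K assms, of l] xy t
    by (simp add: fibre_product_def convex_alt)
  moreover have "f (((1 - t) *\<^sub>R x + t *\<^sub>R y) $ i) = f (((1 - t) *\<^sub>R x + t *\<^sub>R y) $ j)" for i j
  proof -
    have "f (x $ i) = f (x $ j)" "f (y $ i) = f (y $ j)"
      using xy unfolding fibre_product_def by blast+
    then show ?thesis
      unfolding f by simp
  qed
  ultimately show "(1 - t) *\<^sub>R x + t *\<^sub>R y \<in> fibre_product f s"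
    unfolding fibre_product_def by blast
qed

text \<open>One coordinate determines the common value under \<open>f\<close>, which determines
  every other coordinate by injectivity on \<open>s i\<close>.\<close>

lemma inj_on_projection:
  fixes s :: "'k::finite \<Rightarrow> 'a set"
  assumes "\<And>l. s l \<in> K"
  shows "inj_on (\<lambda>z. z $ l) (fibre_product f s)"
proof (rule inj_onI)
  fix z w assume zw: "z \<in> fibre_product f s" "w \<in> fibre_product f s" "z $ l = w $ l"
  have "z $ i = w $ i" for i
  proof -
    have "f (z $ i) = f (w $ i)"
      using zw unfolding fibre_product_def by (metis (mono_tags, lifting) mem_Collect_eq)
    then show ?thesis
      using inj_onD[OF inj_on_simplex[OF assms], of "z $ i" "w $ i" i] zw(1,2)
      by (simp add: fibre_product_def)
  qed
  then show "z = w"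
    by (simp add: vec_eq_iff)
qed

lemma projection_fibre_product:
  fixes s :: "'k::finite \<Rightarrow> 'a set"
  assumes "compatible s \<tau>"
  shows "(\<lambda>z. z $ l) ` fibre_product f s = s l"
proof
  show "s l \<subseteq> (\<lambda>z. z $ l) ` fibre_product f s"
  proof
    fix x assume x: "x \<in> s l"
    have "\<forall>i. \<exists>u\<in>s i. f u = f x"
    proof
      fix i
      have "f x \<in> f ` s i"
        using assms x unfolding compatible_def by blast
      then show "\<exists>u\<in>s i. f u = f x" by force
    qed
    then obtain u where u: "\<And>i. u i \<in> s i" "\<And>i. f (u i) = f x" by metis
    \<comment> \<open>The points \<open>u i\<close> over \<open>f x\<close> were chosen freely;
      injectivity forces the one in \<open>s l\<close> to be \<open>x\<close>.\<close>
    have "u l = x"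
      using inj_on_simplex[of "s l"] assms u x by (meson compatible_def inj_onD)
    moreover have "(\<chi> i. u i) \<in> fibre_product f s"
      using u by (simp add: fibre_product_def)
    ultimately show "x \<in> (\<lambda>z. z $ l) ` fibre_product f s"
      by (metis imageI vec_lambda_beta)
  qed
qed (auto simp: fibre_product_def)

text \<open>Linear maps send the relative interior of a convex set onto that of its image, and the
  projection is injective here. Hence one arbitrary coordinate decides.\<close>

lemma rel_interior_fibre_product:
  fixes s :: "'k::finite \<Rightarrow> 'a set"
  assumes "compatible s \<tau>" "z \<in> fibre_product f s"
  shows "z \<in> rel_interior (fibre_product f s) \<longleftrightarrow> z $ l \<in> rel_interior (s l)"
proof -
  have K: "\<And>l. s l \<in> K"
    using assms(1) by (simp add: compatible_def)
  have "rel_interior (s l) = (\<lambda>z. z $ l) ` rel_interior (fibre_product f s)"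
    using rel_interior_convex_linear_image[OF linear_vec_nth convex_fibre_product[of s, OF K], of l]
      projection_fibre_product[OF assms(1), of l] by simp
  then show ?thesis
    using inj_on_image_mem_iff[OF inj_on_projection[of s, OF K] assms(2) rel_interior_subset] by simp
qed

section \<open>Lifted vertices and the fibre product as a simplex\<close>

lemma vertex_over:
  assumes "\<sigma> \<in> K" "w \<in> verts (f ` \<sigma>)"
  shows "vertex_over \<sigma> f w \<in> verts \<sigma> \<and> f (vertex_over \<sigma> f w) = w"
proof -
  have "verts \<sigma> \<subseteq> \<sigma>"
    by (auto simp: verts_def extreme_point_of_def)
  moreover have "w \<in> f ` verts \<sigma>"
    using verts_affine_image[OF affine_on_simplex _ inj_on_simplex] assms
      geometric_complexD(3)[OF complex_K] by blast
  ultimately have "\<exists>!v. v \<in> verts \<sigma> \<and> f v = w"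
    using inj_on_simplex[OF assms(1)] by (auto dest: inj_onD)
  then show ?thesis
    unfolding vertex_over_def by (rule theI')
qed

lemma vertex_over_image:
  assumes "\<sigma> \<in> K"
  shows "vertex_over \<sigma> f ` verts (f ` \<sigma>) = verts \<sigma>"
proof -
  have sub: "verts \<sigma> \<subseteq> \<sigma>"
    by (auto simp: verts_def extreme_point_of_def)
  have im: "verts (f ` \<sigma>) = f ` verts \<sigma>"
    using verts_affine_image[OF affine_on_simplex _ inj_on_simplex] assms
      geometric_complexD(3)[OF complex_K] by blast
  have "vertex_over \<sigma> f (f v) = v" if "v \<in> verts \<sigma>" for v
    using vertex_over[OF assms, of "f v"] that im inj_onD[OF inj_on_simplex[OF assms]] sub by blast
  then show ?thesis
    by (simp add: im image_image)
qed

definition lifted_verts :: "('k \<Rightarrow> 'a set) \<Rightarrow> 'b set \<Rightarrow> ('a ^ 'k) set" where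
  "lifted_verts s \<tau> = (\<lambda>w. \<chi> l. vertex_over (s l) f w) ` verts \<tau>"

context
  fixes s :: "'k::finite \<Rightarrow> 'a set" and \<tau> :: "'b set"
  assumes comp: "compatible s \<tau>"
begin

lemma lifted_verts_subset: "lifted_verts s \<tau> \<subseteq> fibre_product f s"
proof -
  have "vertex_over (s l) f w \<in> s l" "f (vertex_over (s l) f w) = w" if "w \<in> verts \<tau>" for l w
  proof -
    have "s l \<in> K" "w \<in> verts (f ` s l)"
      using comp that by (auto simp: compatible_def)
    then show "vertex_over (s l) f w \<in> s l" "f (vertex_over (s l) f w) = w"
      using vertex_over[of "s l" w] by (auto simp: verts_def extreme_point_of_def)
  qed
  then show ?thesis
    by (auto simp: lifted_verts_def fibre_product_def)
qed

lemma projection_lifted_verts: "(\<lambda>z. z $ l) ` lifted_verts s \<tau> = verts (s l)"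
  using vertex_over_image[of "s l"] comp by (simp add: lifted_verts_def image_image compatible_def)

text \<open>The hull lies in the fibre product and has the same image \<open>s l\<close> under a
  projection that is injective on the fibre product.\<close>

lemma fibre_product_eq_hull: "fibre_product f s = convex hull lifted_verts s \<tau>"
proof
  have K: "s l \<in> K" for l
    using comp by (simp add: compatible_def)
  show sup: "convex hull lifted_verts s \<tau> \<subseteq> fibre_product f s"
    by (intro hull_minimal lifted_verts_subset convex_fibre_product K)
  show "fibre_product f s \<subseteq> convex hull lifted_verts s \<tau>"
  proof
    fix z assume z: "z \<in> fibre_product f s"
    \<comment> \<open>Any coordinate serves; one exists because the index type is inhabited, that
      is, \<open>k\<close> is at least 1.\<close>
    fix l
    have "(\<lambda>z. z $ l) ` (convex hull lifted_verts s \<tau>) = s l"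
      using convex_hull_linear_image[OF linear_vec_nth] projection_lifted_verts
        geometric_complexD(4)[OF complex_K K] by metis
    then have "z $ l \<in> (\<lambda>z. z $ l) ` (convex hull lifted_verts s \<tau>)"
      using z by (simp add: fibre_product_def)
    then show "z \<in> convex hull lifted_verts s \<tau>"
      using inj_on_image_mem_iff[OF inj_on_projection[of s, OF K] z sup] by simp
  qed
qed

lemma fibre_product_simplex: "\<exists>n. n simplex (fibre_product f s)"
proof -
  fix l
  have K: "s l \<in> K" for l
    using comp by (simp add: compatible_def)
  have "inj_on (\<lambda>z. z $ l) (lifted_verts s \<tau>)"
    using inj_on_projection[of s, OF K] lifted_verts_subset inj_on_subset by blast
  then have "\<not> affine_dependent (lifted_verts s \<tau>)"
    using affine_independent_linear_preimage[OF linear_vec_nth] projection_lifted_verts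
      geometric_complexD(5)[OF complex_K K] by metis
  then have "(int (card (lifted_verts s \<tau>)) - 1) simplex fibre_product f s"
    unfolding simplex_def fibre_product_eq_hull by (intro exI[of _ "lifted_verts s \<tau>"]) simp
  then show ?thesis by blast
qed

end

section \<open>The triangulation of \<open>W\<close>\<close>

abbreviation carriers :: "'a ^ 'k \<Rightarrow> 'k \<Rightarrow> 'a set" where
  "carriers x \<equiv> \<lambda>l. carrier_simplex K (x $ l)"

lemma W_k_coord:
  assumes "x \<in> W_k (\<Union>K) f"
  shows "x $ l \<in> \<Union>K"
  using assms by (simp add: W_k_def cartesian_power_def)

text \<open>The image of each carrier is a simplex of \<open>L\<close> with the common value in its
  relative interior, so it is the carrier of that value.\<close>

lemma carriers_compatible:
  fixes x :: "'a ^ 'k"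
  assumes "x \<in> W_k (\<Union>K) f"
  shows "compatible (carriers x) (carrier_simplex L (common_value f x))"
proof -
  have "f ` carrier_simplex K (x $ l) = carrier_simplex L (common_value f x)" for l
  proof -
    note c = carrier_simplex[OF complex_K W_k_coord[OF assms, of l]]
    have "common_value f x = f (x $ l)"
      unfolding common_value_def using assms by (intro the_equality) (auto simp: W_k_def)
    moreover have "f (x $ l) \<in> rel_interior (f ` carrier_simplex K (x $ l))"
      using rel_interior_affine_image affine_on_simplex geometric_complexD(3)[OF complex_K] c by blast
    ultimately show ?thesis
      using carrier_simplex_eqI[OF complex_L image_simplex[OF c(1)]] by simp
  qed
  then show ?thesis
    using carrier_simplex(1)[OF complex_K W_k_coord[OF assms]] by (simp add: compatible_def)
qed

lemma carriers_in_K: "x \<in> W_k (\<Union>K) f \<Longrightarrow> carriers x l \<in> K"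
  using carrier_simplex(1)[OF complex_K W_k_coord] .

lemma Gamma_k_eq:
  assumes "x \<in> W_k (\<Union>K) f"
  shows "Gamma_k K L f x = fibre_product f (carriers x)"
  using fibre_product_eq_hull[OF carriers_compatible[OF assms]]
  by (simp add: Gamma_k_def lifted_verts_def)

lemma Gamma_k_subset_W: "x \<in> W_k (\<Union>K) f \<Longrightarrow> Gamma_k K L f x \<subseteq> W_k (\<Union>K) f"
  using carriers_in_K[of x] unfolding Gamma_k_eq
  by (auto simp: fibre_product_def W_k_def cartesian_power_def)

lemma rel_interior_Gamma_k:
  assumes "x \<in> W_k (\<Union>K) f"
  shows "x \<in> rel_interior (Gamma_k K L f x)"
proof -
  note c = carrier_simplex[OF complex_K W_k_coord[OF assms]]
  have "x \<in> fibre_product f (carriers x)"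
    using assms c(3) by (simp add: fibre_product_def W_k_def)
  then show ?thesis
    using rel_interior_fibre_product[OF carriers_compatible[OF assms]] c(2)
    by (simp add: Gamma_k_eq[OF assms])
qed

lemma mem_Gamma_k: "x \<in> W_k (\<Union>K) f \<Longrightarrow> x \<in> Gamma_k K L f x"
  using rel_interior_Gamma_k rel_interior_subset by blast

lemma convex_Gamma_k: "convex (Gamma_k K L f x)"
  by (simp add: Gamma_k_def)

lemma simplex_Gamma_k: "x \<in> W_k (\<Union>K) f \<Longrightarrow> \<exists>n. n simplex (Gamma_k K L f x)"
  using fibre_product_simplex[OF carriers_compatible] by (simp add: Gamma_k_eq)

text \<open>Each \<open>z $ l\<close> lies in the carrier of \<open>x $ l\<close>, so its own
  carrier is a face of that one; faces pass to fibre products.\<close>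

lemma Gamma_k_face:
  assumes x: "x \<in> W_k (\<Union>K) f" and z: "z \<in> Gamma_k K L f x"
  shows "Gamma_k K L f z face_of Gamma_k K L f x"
proof -
  have zW: "z \<in> W_k (\<Union>K) f"
    using Gamma_k_subset_W x z by blast
  have "carriers z l face_of carriers x l" for l
  proof (rule rel_interior_imp_face[OF complex_K])
    show "z $ l \<in> carriers x l"
      using z by (simp add: Gamma_k_eq[OF x] fibre_product_def)
  qed (use carriers_in_K x zW carrier_simplex(2)[OF complex_K W_k_coord[OF zW]] in auto)
  then show ?thesis
    using fibre_product_face[of f "carriers x" "carriers z"] convex_Gamma_k[of x]
    by (simp add: Gamma_k_eq x zW)
qed

text \<open>For \<open>z\<close> in the relative interior of \<open>F\<close>, both \<open>F\<close>
  and the simplex of \<open>z\<close> are faces with \<open>z\<close> relatively interior, so they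
  coincide.\<close>

lemma face_of_Gamma_k:
  assumes x: "x \<in> W_k (\<Union>K) f" and F: "F face_of Gamma_k K L f x" "F \<noteq> {}"
  shows "\<exists>z\<in>F. F = Gamma_k K L f z"
proof -
  obtain z where z: "z \<in> rel_interior F"
    using F face_of_imp_convex rel_interior_eq_empty by blast
  then have "z \<in> F" "z \<in> Gamma_k K L f x"
    using F(1) face_of_imp_subset rel_interior_subset by blast+
  moreover from this have "z \<in> rel_interior (Gamma_k K L f z)"
    using rel_interior_Gamma_k Gamma_k_subset_W x by blast
  ultimately show ?thesis
    using face_of_eq[OF F(1) Gamma_k_face[OF x]] z by blast
qed

text \<open>Intersecting fibre products intersects the carriers coordinatewise; an empty
  intersection is covered, \<open>{}\<close> being a face.\<close>

lemma Gamma_k_Int_face: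
  fixes x x' :: "'a ^ 'k"
  assumes x: "x \<in> W_k (\<Union>K) f" and x': "x' \<in> W_k (\<Union>K) f"
  shows "Gamma_k K L f x \<inter> Gamma_k K L f x' face_of Gamma_k K L f x"
proof -
  have "carriers x l \<inter> carriers x' l face_of carriers x l" for l
    using complex_K carriers_in_K x x' unfolding geometric_complex_def by blast
  moreover have "Gamma_k K L f x \<inter> Gamma_k K L f x' =
      fibre_product f (\<lambda>l. carriers x l \<inter> carriers x' l)"
    by (auto simp: Gamma_k_eq x x' fibre_product_def)
  ultimately show ?thesis
    using fibre_product_face[of f "carriers x" "\<lambda>l. carriers x l \<inter> carriers x' l"]
      convex_Gamma_k[of x] by (simp add: Gamma_k_eq[OF x])
qed

text \<open>Common criterion for \<open>D\<close> and \<open>W\<close>: a subset of \<open>W\<close>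
  that contains the simplex of each of its points is triangulated by these simplices.\<close>

lemma complex_structure_Gamma_k:
  fixes S :: "('a ^ 'k) set"
  assumes "S \<subseteq> W_k (\<Union>K) f" "\<And>x. x \<in> S \<Longrightarrow> Gamma_k K L f x \<subseteq> S"
  shows "complex_structure_on (Gamma_k K L f ` S) S"
  unfolding complex_structure_on_def geometric_complex_def
proof (intro conjI ballI allI impI)
  fix \<sigma> assume "\<sigma> \<in> Gamma_k K L f ` S"
  then obtain x where x: "x \<in> S" "\<sigma> = Gamma_k K L f x" "x \<in> W_k (\<Union>K) f"
    using assms(1) by blast
  show "\<sigma> \<noteq> {}" "\<exists>n. n simplex \<sigma>"
    using x mem_Gamma_k simplex_Gamma_k by blast+
  show "F \<in> Gamma_k K L f ` S" if F: "F face_of \<sigma> \<and> F \<noteq> {}" for F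
  proof -
    obtain z where "z \<in> F" "F = Gamma_k K L f z"
      using face_of_Gamma_k x F by blast
    moreover have "F \<subseteq> S"
      using F x assms(2) face_of_imp_subset by blast
    ultimately show ?thesis by blast
  qed
  fix \<tau> assume "\<tau> \<in> Gamma_k K L f ` S"
  then obtain x' where x': "\<tau> = Gamma_k K L f x'" "x' \<in> W_k (\<Union>K) f"
    using assms(1) by blast
  show "\<sigma> \<inter> \<tau> face_of \<sigma>" "\<sigma> \<inter> \<tau> face_of \<tau>"
    using Gamma_k_Int_face[OF x(3) x'(2)] Gamma_k_Int_face[OF x'(2) x(3)]
    by (simp_all add: x(2) x'(1) Int_commute)
next
  show "\<Union> (Gamma_k K L f ` S) = S"
    using assms mem_Gamma_k by blast
qed

section \<open>The multiple point set\<close>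

text \<open>This is \<open>D\<^sub>0\<close>, spelled exactly as inside \<open>D_k\<close> so that
  unfolding \<open>D_k\<close> produces it.\<close>

abbreviation D_open :: "('a ^ 'k) set" where
  "D_open \<equiv> {x \<in> cartesian_power (\<Union>K).
    (\<forall>i j. f (x $ i) = f (x $ j)) \<and> (\<forall>i j. i \<noteq> j \<longrightarrow> x $ i \<noteq> x $ j)}"

lemma D_k_eq: "(D_k (\<Union>K) f :: ('a ^ 'k) set) = cartesian_power (\<Union>K) \<inter> closure D_open"
proof -
  have "cartesian_power (\<Union>K) \<inter> (D_open :: ('a ^ 'k) set) = D_open"
    by blast
  then show ?thesis
    unfolding D_k_def closure_of_subtopology by simp
qed

lemma D_open_subset_W: "D_open \<subseteq> W_k (\<Union>K) f"
  by (auto simp: W_k_def)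

lemma Gamma_k_subset_D:
  fixes x :: "'a ^ 'k"
  assumes "x \<in> D_open"
  shows "Gamma_k K L f x \<subseteq> D_k (\<Union>K) f"
proof -
  have xW: "x \<in> W_k (\<Union>K) f"
    using assms D_open_subset_W by blast
  have "rel_interior (Gamma_k K L f x) \<subseteq> D_open"
  proof
    fix z assume z: "z \<in> rel_interior (Gamma_k K L f x)"
    then have zG: "z \<in> Gamma_k K L f x"
      using rel_interior_subset by blast
    have zW: "z \<in> W_k (\<Union>K) f"
      using zG Gamma_k_subset_W[OF xW] by blast
    have ri: "z $ l \<in> rel_interior (carriers x l)" for l
      using z zG rel_interior_fibre_product[OF carriers_compatible[OF xW]]
      by (simp add: Gamma_k_eq[OF xW])
    have "z $ i \<noteq> z $ j" if "i \<noteq> j" for i j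
    proof
      assume "z $ i = z $ j"
      \<comment> \<open>\<open>z $ l\<close> is relatively interior to the carrier of
        \<open>x $ l\<close> and so determines it. Then \<open>x $ i\<close> and
        \<open>x $ j\<close> share a simplex, on which \<open>f\<close> is injective.\<close>
      then have "carriers x i = carriers x j"
        using carrier_simplex_eqI[OF complex_K carriers_in_K[OF xW] ri] by metis
      then have "x $ i \<in> carriers x i" "x $ j \<in> carriers x i"
        using carrier_simplex(3)[OF complex_K W_k_coord[OF xW]] by metis+
      moreover have "f (x $ i) = f (x $ j)" "x $ i \<noteq> x $ j"
        using assms that by auto
      ultimately show False
        using inj_onD[OF inj_on_simplex[OF carriers_in_K[OF xW]]] by blast
    qed
    then show "z \<in> D_open"
      using zW by (simp add: W_k_def)
  qed
  then have "closure (rel_interior (Gamma_k K L f x)) \<subseteq> closure D_open"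
    by (rule closure_mono)
  then have "Gamma_k K L f x \<subseteq> closure D_open"
    using convex_closure_rel_interior[OF convex_Gamma_k] closure_subset by blast
  moreover have "Gamma_k K L f x \<subseteq> cartesian_power (\<Union>K)"
    using Gamma_k_subset_W[OF xW] by (auto simp: W_k_def)
  ultimately show ?thesis
    by (simp add: D_k_eq)
qed

text \<open>Near \<open>x\<close>, finitely many simplices cover \<open>D_open\<close>; their union
  is closed, so it also contains the limit point \<open>x\<close>.\<close>

lemma D_k_covered:
  fixes x :: "'a ^ 'k"
  assumes "x \<in> D_k (\<Union>K) f"
  shows "\<exists>u\<in>D_open. x \<in> Gamma_k K L f u"
proof -
  have x: "x $ l \<in> \<Union>K" "x \<in> closure D_open" for l
    using assms by (auto simp: D_k_eq cartesian_power_def)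
  have ex: "\<exists>U. open U \<and> x $ l \<in> U \<and> finite {\<sigma> \<in> K. \<sigma> \<inter> (\<Union>K \<inter> U) \<noteq> {}}" for l
  proof -
    obtain V where V: "openin (top_of_set (\<Union>K)) V" "x $ l \<in> V" "finite {\<sigma> \<in> K. \<sigma> \<inter> V \<noteq> {}}"
      using loc_fin_K x(1)[of l] unfolding locally_finite_complex_def locally_finite_in_def by auto
    obtain U where U: "open U" "V = \<Union>K \<inter> U"
      using V(1) unfolding openin_open by blast
    show ?thesis
      using V(2,3) U by (intro exI[of _ U]) simp
  qed
  from choice[OF allI, OF ex] obtain U where
    "\<forall>l. open (U l) \<and> x $ l \<in> U l \<and> finite {\<sigma> \<in> K. \<sigma> \<inter> (\<Union>K \<inter> U l) \<noteq> {}}" ..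
  then have U: "\<And>l. open (U l)" "\<And>l. x $ l \<in> U l"
      "\<And>l. finite {\<sigma> \<in> K. \<sigma> \<inter> (\<Union>K \<inter> U l) \<noteq> {}}"
    by simp_all
  define B where "B = {z :: 'a ^ 'k. \<forall>l. z $ l \<in> U l}"
  have "open B"
    unfolding B_def using U(1) by (intro open_vector_box) simp
  \<comment> \<open>For \<open>u\<close> in the box \<open>B\<close>, the carrier of
    \<open>u $ l\<close> meets \<open>U l\<close>. This leaves finitely many families of carriers,
    and the family determines the simplex.\<close>
  define \<G> where "\<G> = Gamma_k K L f ` (B \<inter> D_open)"
  have "carriers ` (B \<inter> D_open) \<subseteq> {s. \<forall>l. s l \<in> {\<sigma> \<in> K. \<sigma> \<inter> (\<Union>K \<inter> U l) \<noteq> {}}}"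
  proof clarify
    fix u :: "'a ^ 'k" and l
    assume "u \<in> B" "u \<in> cartesian_power (\<Union>K)"
    then have "u $ l \<in> \<Union>K \<inter> U l"
      by (simp add: B_def cartesian_power_def)
    then show "carriers u l \<in> K \<and> carriers u l \<inter> (\<Union>K \<inter> U l) \<noteq> {}"
      using carrier_simplex(1,3)[OF complex_K] by blast
  qed
  moreover have "finite {s. \<forall>l. s l \<in> {\<sigma> \<in> K. \<sigma> \<inter> (\<Union>K \<inter> U l) \<noteq> {}}}"
    using finite_PiE[of UNIV "\<lambda>l. {\<sigma> \<in> K. \<sigma> \<inter> (\<Union>K \<inter> U l) \<noteq> {}}"] U(3)
    by (simp add: PiE_def Pi_def)
  ultimately have "finite (carriers ` (B \<inter> D_open))"
    using finite_subset by blast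
  moreover have "\<G> = fibre_product f ` carriers ` (B \<inter> D_open)"
    unfolding \<G>_def image_image using D_open_subset_W
    by (intro image_cong refl Gamma_k_eq) blast
  ultimately have "finite \<G>"
    by simp
  moreover have "closed G" if G: "G \<in> \<G>" for G
  proof -
    obtain u where u: "u \<in> D_open" "G = Gamma_k K L f u"
      using G unfolding \<G>_def by blast
    obtain n where "n simplex G"
      using simplex_Gamma_k[OF subsetD[OF D_open_subset_W u(1)]] u(2) by blast
    then show ?thesis
      using simplex_imp_polytope polytope_imp_closed by blast
  qed
  ultimately have "closed (\<Union>\<G>)"
    by (intro closed_Union) auto
  moreover have "B \<inter> D_open \<subseteq> \<Union>\<G>"
  proof
    fix u assume u: "u \<in> B \<inter> D_open"
    then have "u \<in> Gamma_k K L f u"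
      by (intro mem_Gamma_k subsetD[OF D_open_subset_W]) (rule IntD2)
    with u show "u \<in> \<Union>\<G>"
      unfolding \<G>_def by (rule UN_I)
  qed
  ultimately have "closure (B \<inter> D_open) \<subseteq> \<Union>\<G>"
    by (simp add: closure_minimal)
  \<comment> \<open>As \<open>B\<close> is an open neighbourhood of \<open>x\<close>, restricting
    \<open>D_open\<close> to \<open>B\<close> keeps \<open>x\<close> in the closure.\<close>
  moreover have "x \<in> closure (B \<inter> D_open)"
  proof (rule subsetD[OF open_Int_closure_subset[OF \<open>open B\<close>]])
    show "x \<in> B \<inter> closure D_open"
      using x(2) U(2) by (simp add: B_def)
  qed
  ultimately have "x \<in> \<Union>\<G>"
    by (rule subsetD)
  then obtain u where "u \<in> B \<inter> D_open" "x \<in> Gamma_k K L f u"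
    unfolding \<G>_def by (rule UN_E)
  then show ?thesis
    by (intro bexI[of _ u]) (simp_all del: mem_Collect_eq)
qed

text \<open>That the closure stays in \<open>W\<close> comes from the covering by simplices of
  \<open>W\<close>, not from continuity of \<open>f\<close>.\<close>

lemma D_k_subset_W: "D_k (\<Union>K) f \<subseteq> W_k (\<Union>K) f"
  using D_k_covered Gamma_k_subset_W D_open_subset_W by blast

text \<open>The point \<open>x\<close> lies in a simplex of some \<open>u\<close> in
  \<open>D_open\<close>, and the simplex of \<open>x\<close> is a face of it.\<close>

lemma Gamma_k_subset_D_k:
  fixes x :: "'a ^ 'k"
  assumes "x \<in> D_k (\<Union>K) f"
  shows "Gamma_k K L f x \<subseteq> D_k (\<Union>K) f"
proof -
  obtain u where u: "u \<in> D_open" "x \<in> Gamma_k K L f u"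
    using D_k_covered[OF assms] by blast
  then have "Gamma_k K L f x \<subseteq> Gamma_k K L f u"
    using Gamma_k_face face_of_imp_subset D_open_subset_W by blast
  then show ?thesis
    using Gamma_k_subset_D[OF u(1)] by blast
qed

end

theorem corollary4p7:
  fixes K :: "(real ^ 'N) set set" and L :: "(real ^ 'P) set set"
    and f :: "real ^ 'N \<Rightarrow> real ^ 'P"
    and D :: "((real ^ 'N) ^ 'k) set" and W :: "((real ^ 'N) ^ 'k) set"
  assumes "locally_finite_complex K" and "locally_finite_complex L"
    and "simplicial_map K L f"
    and "f ` (\<Union>K) = \<Union>L"
    and "\<forall>y\<in>\<Union>L. finite {x \<in> \<Union>K. f x = y}"
    and "D = D_k (\<Union>K) f" and "W = W_k (\<Union>K) f"
  shows "complex_structure_on (Gamma_k K L f ` D) D \<and>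
         complex_structure_on (associated_triangulation K L f) W \<and>
         subcomplex (Gamma_k K L f ` D) (associated_triangulation K L f)"
proof -
  interpret finite_fibre_simplicial_map K L f
    using assms by unfold_locales (auto simp: locally_finite_complex_def)
  have D: "complex_structure_on (Gamma_k K L f ` D) D"
    unfolding assms(6) by (intro complex_structure_Gamma_k D_k_subset_W Gamma_k_subset_D_k)
  have W: "complex_structure_on (associated_triangulation K L f) W"
    unfolding assms(7) associated_triangulation_def
    by (intro complex_structure_Gamma_k Gamma_k_subset_W order_refl)
  have "Gamma_k K L f ` D \<subseteq> associated_triangulation K L f"
    unfolding assms(6) associated_triangulation_def by (intro image_mono D_k_subset_W)
  with D W show ?thesis
    by (simp add: subcomplex_def complex_structure_on_def)
qed

end
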